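(* Let $a,b,c,g$ be complex parameters and put $$A_0=\frac{2a+2c+g+2}{2},\quad A_1=\frac{2b+2c+g+2}{2},\quad A_2=\frac{-g}{2},\quad A_3=\frac{2a+2b+g+2}{2}.$$ Then the operator $R(A_0,A_1,A_2,A_3)$ exactly coincides with the Dotsenko–Fateev operator $S(a,b,c,g)$.
   Context: With $\partial=d/dx$, $R(A)=x^2(x-1)^2\partial^3+r_1\partial^2+r_2\partial+r_3$, where \begin{align*} r_1&=(1-x)x(3A_0x-3A_0+3A_1x+2A_2x-A_2-6x+3),\\ r_2&=3A_0^2x^2-5A_0^2x+2A_0^2+6A_0A_1x^2-6A_0A_1x+4A_0A_2x^2-6A_0A_2x+2A_0A_2\\ &\quad-9A_0x^2+12A_0x-3A_0+3A_1^2x^2-A_1^2x+4A_1A_2x^2-2A_1A_2x-9A_1x^2+6A_1x\\ &\quad+A_2^2x^2-A_2^2x-6A_2x^2+6A_2x-A_2-A_3^2x^2+A_3^2x+7x^2-7x+1,\\ r_3&=-\tfrac12(2A_0x-2A_0+2A_1x-2x+1)(A_0+A_1+A_2-A_3-1)(A_0+A_1+A_2+A_3-1). \end{align*} The Dotsenko–Fateev operator is $S(a,b,c,g)=x^2(x-1)^2\partial^3+s_1\partial^2+s_2\partial+s_3$, where \begin{align*} s_1&=-(x-1)x(3ax+3bx+6cx+2gx-3a-3c-g),\\ s_2&=2a^2x^2+4abx^2+12acx^2+3agx^2+2b^2x^2+12bcx^2+3bgx^2+12c^2x^2+8cgx^2\\ &\quad+g^2x^2-4a^2x-4abx-16acx-4agx+ax^2-8bcx-2bgx+bx^2-12c^2x-8cgx+6cx^2\\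 &\quad-g^2x+gx^2+2a^2+4ac+ag-2ax+2c^2+cg-6cx-gx+a+c,\\ s_3&=-c(2a+2+2b+2c+g)(2ax+2bx+4cx+2gx-2a-2c-g+2x-1). \end{align*} *)

theory Defs
  imports Complex_Main "HOL-Computational_Algebra.Polynomial"
begin

text \<open>
  A linear differential operator $p_0 + p_1 \partial + \dots + p_n \partial^n$ with
  $p_i \in \mathbb{C}[x]$, viewed as an element of the Weyl algebra
  $\mathbb{C}[x]\langle\partial\rangle \subseteq \mathrm{End}(\mathbb{C}[x])$. The argument
  \<open>L\<close> only lists the coefficients, \<open>coeff L i\<close> standing to the left of $\partial^i$;
  the (commutative) product of \<^typ>\<open>complex poly poly\<close> is not composition of operators.
\<close>

definition diff_op :: "complex poly poly \<Rightarrow> complex poly \<Rightarrow> complex poly" where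
  "diff_op L f = (\<Sum>i\<le>degree L. coeff L i * (pderiv ^^ i) f)"

definition R_op :: "complex \<Rightarrow> complex \<Rightarrow> complex \<Rightarrow> complex \<Rightarrow> complex poly \<Rightarrow> complex poly" where
  "R_op a0 a1 a2 a3 =
    (let x = [:0, 1:]; A0 = [:a0:]; A1 = [:a1:]; A2 = [:a2:]; A3 = [:a3:];
         r1 = (1 - x)*x*(3*A0*x - 3*A0 + 3*A1*x + 2*A2*x - A2 - 6*x + 3);
         r2 = 3*A0^2*x^2 - 5*A0^2*x + 2*A0^2 + 6*A0*A1*x^2 - 6*A0*A1*x + 4*A0*A2*x^2
              - 6*A0*A2*x + 2*A0*A2
              - 9*A0*x^2 + 12*A0*x - 3*A0 + 3*A1^2*x^2 - A1^2*x + 4*A1*A2*x^2 - 2*A1*A2*x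
              - 9*A1*x^2 + 6*A1*x
              + A2^2*x^2 - A2^2*x - 6*A2*x^2 + 6*A2*x - A2 - A3^2*x^2 + A3^2*x
              + 7*x^2 - 7*x + 1;
         r3 = smult (- (1/2))
                ((2*A0*x - 2*A0 + 2*A1*x - 2*x + 1)*(A0 + A1 + A2 - A3 - 1)*(A0 + A1 + A2 + A3 - 1))
     in diff_op [:r3, r2, r1, x^2*(x - 1)^2:])"

definition S_op :: "complex \<Rightarrow> complex \<Rightarrow> complex \<Rightarrow> complex \<Rightarrow> complex poly \<Rightarrow> complex poly" where
  "S_op a' b' c' g' =
    (let x = [:0, 1:]; a = [:a':]; b = [:b':]; c = [:c':]; g = [:g':];
         s1 = - (x - 1)*x*(3*a*x + 3*b*x + 6*c*x + 2*g*x - 3*a - 3*c - g);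
         s2 = 2*a^2*x^2 + 4*a*b*x^2 + 12*a*c*x^2 + 3*a*g*x^2 + 2*b^2*x^2 + 12*b*c*x^2
              + 3*b*g*x^2 + 12*c^2*x^2 + 8*c*g*x^2
              + g^2*x^2 - 4*a^2*x - 4*a*b*x - 16*a*c*x - 4*a*g*x + a*x^2 - 8*b*c*x - 2*b*g*x
              + b*x^2 - 12*c^2*x - 8*c*g*x + 6*c*x^2
              - g^2*x + g*x^2 + 2*a^2 + 4*a*c + a*g - 2*a*x + 2*c^2 + c*g - 6*c*x - g*x + a + c;
         s3 = - c*(2*a + 2 + 2*b + 2*c + g)
                *(2*a*x + 2*b*x + 4*c*x + 2*g*x - 2*a - 2*c - g + 2*x - 1)
     in diff_op [:s3, s2, s1, x^2*(x - 1)^2:])"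

lemma diff_op_altdef:
  assumes "degree L \<le> n"
  shows "diff_op L f = (\<Sum>i\<le>n. coeff L i * (pderiv ^^ i) f)"
  unfolding diff_op_def
  by (rule sum.mono_neutral_left) (use assms in \<open>auto simp: coeff_eq_0\<close>)

lemma diff_op_cubic:
  "diff_op [:p0, p1, p2, p3:] f =
     p3 * pderiv (pderiv (pderiv f)) + p2 * pderiv (pderiv f) + p1 * pderiv f + p0 * f"
proof -
  have "degree [:p0, p1, p2, p3:] \<le> 3"
    by (auto simp: degree_pCons_eq_if)
  from diff_op_altdef[OF this] show ?thesis
    by (simp add: eval_nat_numeral algebra_simps)
qed

lemma higher_pderiv_monom_self: "(pderiv ^^ n) (monom (1::complex) n) = [:fact n:]"
proof -
  have "(pderiv ^^ k) (monom c k) = [:c * fact k:]" for k and c :: complex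
  proof (induction k arbitrary: c)
    case (Suc k)
    then show ?case
      by (simp add: funpow_swap1 pderiv_monom mult_ac del: funpow.simps add: funpow_Suc_right)
  qed (simp add: monom_0)
  from this[of n 1] show ?thesis by simp
qed

lemma higher_pderiv_monom_0:
  assumes "n < i"
  shows "(pderiv ^^ i) (monom (1::complex) n) = 0"
proof -
  have "(pderiv ^^ j) (0 :: complex poly) = 0" for j by (induction j) auto
  moreover from assms obtain j where "i = j + Suc n"
    by (metis add.commute less_imp_Suc_add add_Suc_right)
  ultimately show ?thesis
    by (simp add: funpow_add higher_pderiv_monom_self funpow_swap1 pderiv_pCons)
qed

text \<open>
  Equality of operators is the same as equality of all their coefficients, i.e.\ nothing is
  lost by letting them act on polynomials only.
\<close>

lemma diff_op_inject: "diff_op L = diff_op M \<longleftrightarrow> L = M"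
proof
  assume eq: "diff_op L = diff_op M"
  define N where "N = max (degree L) (degree M)"
  have "coeff L n = coeff M n" for n
  proof (induction n rule: less_induct)
    case (less n)
    let ?d = "\<lambda>i. (pderiv ^^ i) (monom (1::complex) n)"
    have *: "diff_op K (monom 1 n) = (\<Sum>i<n. coeff K i * ?d i) + coeff K n * [:fact n:]"
      if "degree K \<le> N" for K
    proof -
      have "diff_op K (monom 1 n) = (\<Sum>i\<le>N + n. coeff K i * ?d i)"
        by (rule diff_op_altdef) (use that in auto)
      also have "\<dots> = (\<Sum>i\<le>n. coeff K i * ?d i)"
        by (rule sum.mono_neutral_right) (auto simp: higher_pderiv_monom_0)
      finally show ?thesis
        by (simp add: lessThan_Suc_atMost[symmetric] higher_pderiv_monom_self)
    qed
    have "coeff L n * [:fact n:] = coeff M n * [:fact n:]"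
      using *[of L] *[of M] eq less.IH by (simp add: N_def)
    then show ?case by (subst (asm) mult_right_cancel) auto
  qed
  then show "L = M" by (rule poly_eqI)
qed simp

end

theory Submission
  imports Defs
begin

text \<open>By \<open>diff_op_inject\<close> it suffices to match coefficients, and each match is a
  polynomial identity. For \<open>r3\<close>, the last two factors become \<open>2*c\<close> and
  \<open>2*a + 2*b + 2*c + g + 2\<close>.\<close>

theorem proposition6p6:
  fixes a b c g A0 A1 A2 A3 :: complex
  assumes "A0 = (2*a + 2*c + g + 2) / 2"
    and "A1 = (2*b + 2*c + g + 2) / 2"
    and "A2 = - g / 2"
    and "A3 = (2*a + 2*b + g + 2) / 2"
  shows "R_op A0 A1 A2 A3 = S_op a b c g"
proof -
  \<comment> \<open>Writing \<open>g = 2 * h\<close> makes all four parameters free of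
    denominators.\<close>
  define h where "h = g / 2"
  have g: "g = 2 * h" and A0: "A0 = a + c + h + 1" and A1: "A1 = b + c + h + 1"
    and A2: "A2 = - h" and A3: "A3 = a + b + h + 1"
    using assms by (simp_all add: h_def field_simps)
  show ?thesis
    unfolding R_op_def S_op_def Let_def g A0 A1 A2 A3 diff_op_inject pCons_eq_iff
    \<comment> \<open>Over the infinite field \<complex>, polynomials agree iff their values do;
      this leaves ring identities for \<open>algebra\<close>.\<close>
    by (simp add: poly_eq_poly_eq_iff [symmetric] fun_eq_iff)
      (intro conjI allI; algebra)
qed

end
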